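(* Fix an integer $H\geq 3$ and $q\in\mathbb{Q}\cap\mathbb{Z}_{2}$. Then the sequence $\left\{ L_{H}\left(R_{n}\left(\Phi\left(L_{n}(q)\right)\right)\right)\right\}_{n\in\mathbb{N}}$ is eventually periodic.
   Context: $\mathbb{Z}_2$ is the ring of $2$-adic integers; $\mathbb{N}=\{0,1,2,\dots\}$. Every $x\in\mathbb{Z}_2$ has a unique expansion $x=\sum_{i\geq0}d_i2^i$ with $d_i\in\{0,1\}$, written $x=d_0d_1d_2\cdots$. The map $\Phi:\mathbb{Z}_2\to\mathbb{Z}_2$ is defined as follows: if $x=\sum_i 2^{e_i}$ with $0\leq e_0<e_1<\cdots$ (finite or infinite sum; $x=0$ corresponds to the empty sum), then $\Phi(x)=-\sum_i 2^{e_i}3^{-i}$ (a $2$-adically convergent sum; $\Phi(0)=0$). The shift $\sigma:\mathbb{Z}_2\to\mathbb{Z}_2$ is $\sigma(d_0d_1d_2\cdots)=d_1d_2\cdots$. For $x\in\mathbb{Z}_2$ and $k\in\mathbb{N}$, $L_k(x)$ denotes the least natural number congruent to $x$ modulo $2^k$ (i.e. $d_0+d_12+\cdots+d_{k-1}2^{k-1}$), and $R_k(x)=\sigma^k(x)=d_kd_{k+1}\cdots$. *)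

theory Defs
  imports Complex_Main "HOL-Library.Infinite_Set"
begin

section \<open>The ring of 2-adic integers\<close>

text \<open>The inverse limit of the rings of integers modulo \<open>2^n\<close>; \<open>residue x n\<close> is the
  representative of \<open>x\<close> modulo \<open>2^n\<close> in \<open>{0..<2^n}\<close>.\<close>

typedef padic2 = "{x :: nat \<Rightarrow> int. \<forall>n. x n = x (Suc n) mod 2 ^ n}"
  morphisms residue Abs_padic2
  by (rule exI[of _ "\<lambda>_. 0"]) simp

setup_lifting type_definition_padic2

lemma residue_Suc: "residue x n = residue x (Suc n) mod 2 ^ n"
  using residue[of x] by blast

lemma mod_Suc_mod: "(a :: int) mod 2 ^ Suc n mod 2 ^ n = a mod 2 ^ n"
  by (rule mod_mod_cancel) simp

lemma residue_mod [simp]: "residue x n mod 2 ^ n = residue x n"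
  by (metis mod_mod_trivial residue_Suc)

lemma residue_nonneg [simp]: "residue x n \<ge> 0"
  by (metis residue_mod pos_mod_sign zero_less_numeral zero_less_power)

lemma residue_less [simp]: "residue x n < 2 ^ n"
  by (metis residue_mod pos_mod_bound zero_less_numeral zero_less_power)

lemma residue_0 [simp]: "residue x 0 = 0"
  using residue_mod[of x 0] by simp

lemma residue_le: "m \<le> n \<Longrightarrow> residue x n mod 2 ^ m = residue x m"
proof (induction n rule: dec_induct)
  case (step k)
  have "residue x (Suc k) mod 2 ^ m = residue x (Suc k) mod 2 ^ k mod 2 ^ m"
    using step(1) by (simp add: mod_mod_cancel le_imp_power_dvd)
  then show ?case using step(3) residue_Suc[of x k] by simp
qed simp

lemma padic2_eqI: "(\<And>n. residue x n = residue y n) \<Longrightarrow> x = y"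
  by (metis residue_inject ext)

instantiation padic2 :: comm_ring_1
begin

lift_definition zero_padic2 :: padic2 is "\<lambda>_. 0" by simp
lift_definition one_padic2 :: padic2 is "\<lambda>n. 1 mod 2 ^ n" by (simp only: mod_Suc_mod simp_thms)
lift_definition plus_padic2 :: "padic2 \<Rightarrow> padic2 \<Rightarrow> padic2" is
  "\<lambda>x y n. (x n + y n) mod 2 ^ n"
  by (metis mod_Suc_mod mod_add_eq)
lift_definition uminus_padic2 :: "padic2 \<Rightarrow> padic2" is "\<lambda>x n. (- x n) mod 2 ^ n"
  by (metis mod_Suc_mod mod_minus_eq)
lift_definition minus_padic2 :: "padic2 \<Rightarrow> padic2 \<Rightarrow> padic2" is
  "\<lambda>x y n. (x n - y n) mod 2 ^ n"
  by (metis mod_Suc_mod mod_diff_eq)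
lift_definition times_padic2 :: "padic2 \<Rightarrow> padic2 \<Rightarrow> padic2" is
  "\<lambda>x y n. (x n * y n) mod 2 ^ n"
  by (metis mod_Suc_mod mod_mult_eq)

instance
proof
  fix a b c :: padic2
  show "a * b * c = a * (b * c)"
    by (rule padic2_eqI) (simp add: times_padic2.rep_eq mod_simps mult.assoc)
  show "a * b = b * a"
    by (rule padic2_eqI) (simp add: times_padic2.rep_eq mult.commute)
  show "1 * a = a"
  proof (rule padic2_eqI)
    fix n
    show "residue (1 * a) n = residue a n"
      by (cases n) (simp_all add: times_padic2.rep_eq one_padic2.rep_eq mod_simps)
  qed
  show "a + b + c = a + (b + c)"
    by (rule padic2_eqI) (simp add: plus_padic2.rep_eq mod_simps add.assoc)
  show "a + b = b + a"
    by (rule padic2_eqI) (simp add: plus_padic2.rep_eq add.commute)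
  show "0 + a = a"
    by (rule padic2_eqI) (simp add: plus_padic2.rep_eq zero_padic2.rep_eq)
  show "- a + a = 0"
    by (rule padic2_eqI)
      (simp add: plus_padic2.rep_eq zero_padic2.rep_eq uminus_padic2.rep_eq mod_simps)
  show "a - b = a + - b"
    by (rule padic2_eqI)
      (simp add: plus_padic2.rep_eq minus_padic2.rep_eq uminus_padic2.rep_eq mod_simps)
  show "(a + b) * c = a * c + b * c"
    by (rule padic2_eqI)
      (simp add: plus_padic2.rep_eq times_padic2.rep_eq mod_simps distrib_right)
  have "residue 0 1 \<noteq> residue 1 1"
    by (simp add: zero_padic2.rep_eq one_padic2.rep_eq)
  then show "(0 :: padic2) \<noteq> 1" by metis
qed

end

lemma residue_of_nat: "residue (of_nat m) n = int m mod 2 ^ n"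
  by (induction m)
    (simp_all add: zero_padic2.rep_eq plus_padic2.rep_eq one_padic2.rep_eq mod_simps)

lemma residue_of_int: "residue (of_int m) n = m mod 2 ^ n"
  by (cases m rule: int_cases2)
    (auto simp: residue_of_nat uminus_padic2.rep_eq mod_simps)

lemma residue_power: "residue (x ^ k) n = residue x n ^ k mod 2 ^ n"
  by (induction k) (simp_all add: one_padic2.rep_eq times_padic2.rep_eq mod_simps)

lemma residue_two_power: "residue (2 ^ k) n = 2 ^ k mod 2 ^ n"
  using residue_of_int[of "2 ^ k" n] by simp

lemma residue_eq_0_iff: "residue x k = 0 \<longleftrightarrow> 2 ^ k dvd x"
proof
  assume "2 ^ k dvd x"
  then show "residue x k = 0"
    by (auto elim!: dvdE simp: times_padic2.rep_eq residue_two_power)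
next
  assume 0: "residue x k = 0"
  have d: "2 ^ k dvd residue x (n + k)" for n
    using residue_le[of k "n + k" x] 0 by (simp add: dvd_eq_mod_eq_0)
  define f where "f n = residue x (n + k) div 2 ^ k" for n
  have f: "f n * 2 ^ k = residue x (n + k)" for n
    using d by (simp add: f_def)
  have "f n = f (Suc n) mod 2 ^ n" for n
  proof -
    have "f n * 2 ^ k = f (Suc n) * 2 ^ k mod 2 ^ (n + k)"
      using residue_Suc[of x "n + k"] f[of n] f[of "Suc n"] by simp
    also have "\<dots> = (f (Suc n) mod 2 ^ n) * 2 ^ k"
      by (simp add: power_add mult_mod_left)
    finally show ?thesis by simp
  qed
  then have "residue (Abs_padic2 f) = f" by (intro Abs_padic2_inverse) blast
  then have "x = 2 ^ k * Abs_padic2 f"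
  proof (intro padic2_eqI, simp add: times_padic2.rep_eq residue_two_power mod_simps)
    fix n
    have "residue x n = residue x (n + k) mod 2 ^ n" by (simp add: residue_le)
    then show "residue x n = 2 ^ k * f n mod 2 ^ n" using f by (simp add: mult.commute)
  qed
  then show "2 ^ k dvd x" by simp
qed

lemma residue_eq_iff: "residue x k = residue y k \<longleftrightarrow> 2 ^ k dvd x - y"
proof -
  have "residue x k = residue y k \<longleftrightarrow> (residue x k - residue y k) mod 2 ^ k = 0"
    by (metis mod_eq_dvd_iff mod_0_imp_dvd dvd_imp_mod_0 residue_mod)
  then show ?thesis
    by (simp flip: residue_eq_0_iff add: minus_padic2.rep_eq)
qed

instance padic2 :: idom
proof
  fix x y :: padic2
  have *: "\<exists>k u. x = 2 ^ k * u \<and> residue u 1 = 1" if "x \<noteq> 0" for x :: padic2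
  proof -
    from that obtain n where n: "residue x n \<noteq> 0"
      by (metis padic2_eqI zero_padic2.rep_eq)
    define m where "m = (LEAST n. residue x n \<noteq> 0)"
    have m: "residue x m \<noteq> 0"
      unfolding m_def using n by (rule LeastI)
    have lt: "residue x i = 0" if "i < m" for i
      using that not_less_Least[of i "\<lambda>n. residue x n \<noteq> 0"] by (simp add: m_def)
    have "m \<noteq> 0" using m by (metis residue_0)
    then obtain k where k: "m = Suc k" by (cases m) auto
    then have "2 ^ k dvd x" using lt by (simp flip: residue_eq_0_iff)
    then obtain u where u: "x = 2 ^ k * u" by (elim dvdE)
    have "residue u 1 \<noteq> 0"
    proof
      assume "residue u 1 = 0"
      then have "2 ^ Suc k dvd x"
        using u by (simp add: residue_eq_0_iff mult_dvd_mono mult.commute)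
      then show False using m k residue_eq_0_iff by blast
    qed
    moreover have "0 \<le> residue u 1" "residue u 1 < 2"
      using residue_less[of u 1] by simp_all
    ultimately show ?thesis using u by (intro exI[of _ k] exI[of _ u]) linarith
  qed
  assume "x \<noteq> 0" "y \<noteq> 0"
  then obtain k u l v where u: "x = 2 ^ k * u" "residue u 1 = 1"
    and v: "y = 2 ^ l * v" "residue v 1 = 1" using *[of x] *[of y] by blast
  have "odd (residue (u * v) (Suc (k + l)))"
  proof -
    have "residue (u * v) 1 = 1" using u v by (simp add: times_padic2.rep_eq)
    then have "residue (u * v) (Suc (k + l)) mod 2 = 1"
      using residue_le[of 1 "Suc (k + l)" "u * v"] by simp
    then show ?thesis by presburger
  qed
  moreover have "residue (x * y) (Suc (k + l)) =
      2 ^ (k + l) * residue (u * v) (Suc (k + l)) mod 2 ^ Suc (k + l)"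
  proof -
    have "x * y = 2 ^ (k + l) * (u * v)" using u v by (simp add: power_add algebra_simps)
    then show ?thesis
      by (metis times_padic2.rep_eq residue_two_power mod_mult_left_eq)
  qed
  ultimately have "residue (x * y) (Suc (k + l)) \<noteq> 0"
    by (simp only: power_Suc2 mod_mult_mult1) (simp add: odd_iff_mod_2_eq_one)
  then show "x * y \<noteq> 0" by (auto simp: zero_padic2.rep_eq)
qed

text \<open>The 2-adic metric: the exponent is the 2-adic valuation of \<open>x - y\<close>.\<close>

instantiation padic2 :: metric_space
begin

definition dist_padic2 :: "padic2 \<Rightarrow> padic2 \<Rightarrow> real" where
  "dist (x :: padic2) y = (if x = y then 0 else (1 / 2) ^ (GREATEST k. 2 ^ k dvd x - y))"

definition uniformity_padic2 :: "(padic2 \<times> padic2) filter" where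
  "uniformity = (INF e\<in>{0<..}. principal {(x, y :: padic2). dist x y < e})"

definition open_padic2 :: "padic2 set \<Rightarrow> bool" where
  "open (U :: padic2 set) = (\<forall>x\<in>U. eventually (\<lambda>(x', y). x' = x \<longrightarrow> y \<in> U) uniformity)"

lemma dist_padic2_le_iff: "dist x y \<le> (1 / 2) ^ k \<longleftrightarrow> residue x k = residue y k"
  for x y :: padic2
proof (cases "x = y")
  case False
  then obtain n where n: "residue x n \<noteq> residue y n" by (metis padic2_eqI)
  have mono: "residue x j = residue y j" if "residue x i = residue y i" "j \<le> i" for i j
    using that residue_le by metis
  define P where "P k \<longleftrightarrow> 2 ^ k dvd x - y" for k
  have P: "P k \<longleftrightarrow> residue x k = residue y k" for k
    by (simp add: P_def residue_eq_iff)
  have b: "i \<le> n" if "P i" for i using that n mono P by (meson nat_le_linear)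
  have P0: "P 0" by (simp add: P_def)
  have G: "P (Greatest P)" using GreatestI_nat[of P 0 n] P0 b by blast
  have "P k \<longleftrightarrow> k \<le> Greatest P"
    using Greatest_le_nat[of P k n] b G mono P by blast
  moreover have "(1 / 2 :: real) ^ Greatest P \<le> (1 / 2) ^ k \<longleftrightarrow> k \<le> Greatest P"
    by (simp add: power_decreasing_iff)
  moreover have "dist x y = (1 / 2) ^ Greatest P"
    using False by (simp add: dist_padic2_def P_def[abs_def])
  ultimately show ?thesis using P by simp
qed (simp add: dist_padic2_def)

instance
proof
  show "uniformity = (INF e\<in>{0<..}. principal {(x, y :: padic2). dist x y < e})"
    by (rule uniformity_padic2_def)
  show "open U = (\<forall>x\<in>U. eventually (\<lambda>(x', y). x' = x \<longrightarrow> y \<in> U) uniformity)"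
    for U :: "padic2 set" by (rule open_padic2_def)
  fix x y z :: padic2
  show "dist x y = 0 \<longleftrightarrow> x = y" by (simp add: dist_padic2_def)
  show "dist x y \<le> dist x z + dist y z"
  proof (cases "x = z \<or> y = z")
    case True
    have "(\<lambda>k. 2 ^ k dvd z - y) = (\<lambda>k. 2 ^ k dvd y - z)"
      by (metis dvd_minus_iff minus_diff_eq)
    then have "dist z y = dist y z" by (auto simp: dist_padic2_def)
    moreover have "dist x x = 0" "dist y y = 0" "dist y z \<ge> 0"
      by (simp_all add: dist_padic2_def)
    ultimately show ?thesis using True by auto
  next
    case False
    then obtain i j where i: "dist x z = (1 / 2) ^ i" and j: "dist y z = (1 / 2) ^ j"
      by (simp add: dist_padic2_def)
    define m where "m = min i j"
    have "(1 / 2 :: real) ^ i \<le> (1 / 2) ^ m" "(1 / 2 :: real) ^ j \<le> (1 / 2) ^ m"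
      by (simp_all add: m_def power_decreasing)
    then have "residue x m = residue z m" "residue y m = residue z m"
      using i j by (simp_all flip: dist_padic2_le_iff)
    then have "dist x y \<le> (1 / 2) ^ m" by (simp add: dist_padic2_le_iff)
    also have "\<dots> \<le> dist x z + dist y z" using i j by (simp add: m_def min_def)
    finally show ?thesis .
  qed
qed

end

lemma tendsto_padic2_iff:
  fixes f :: "nat \<Rightarrow> padic2"
  shows "f \<longlonglongrightarrow> l \<longleftrightarrow> (\<forall>k. \<forall>\<^sub>F n in sequentially. residue (f n) k = residue l k)"
proof
  assume f: "f \<longlonglongrightarrow> l"
  show "\<forall>k. \<forall>\<^sub>F n in sequentially. residue (f n) k = residue l k"
  proof
    fix k
    have "\<forall>\<^sub>F n in sequentially. dist (f n) l < (1 / 2) ^ k"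
      using f by (simp add: tendsto_iff)
    then show "\<forall>\<^sub>F n in sequentially. residue (f n) k = residue l k"
      by eventually_elim (simp flip: dist_padic2_le_iff)
  qed
next
  assume *: "\<forall>k. \<forall>\<^sub>F n in sequentially. residue (f n) k = residue l k"
  show "f \<longlonglongrightarrow> l"
  proof (rule tendstoI)
    fix e :: real assume "e > 0"
    then obtain k where k: "(1 / 2) ^ k < e" using real_arch_pow_inv[of e "1 / 2"] by auto
    from * have "\<forall>\<^sub>F n in sequentially. residue (f n) k = residue l k" by blast
    then show "\<forall>\<^sub>F n in sequentially. dist (f n) l < e"
    proof eventually_elim
      case (elim n)
      then have "dist (f n) l \<le> (1 / 2) ^ k" by (simp add: dist_padic2_le_iff)
      with k show ?case by simp
    qed
  qed
qed

lemma summable_padic2: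
  fixes f :: "nat \<Rightarrow> padic2"
  assumes "\<And>n. 2 ^ n dvd f n"
  shows "summable f"
proof -
  define s where "s n = sum f {..<n}" for n
  have step: "residue (s (Suc n)) k = residue (s n) k" if "k \<le> n" for n k
  proof -
    have "2 ^ k dvd f n" using assms that by (meson dvd_trans le_imp_power_dvd)
    then show ?thesis by (simp add: residue_eq_iff s_def)
  qed
  have const: "residue (s n) k = residue (s k) k" if "k \<le> n" for n k
    using that by (induction n rule: dec_induct) (simp_all add: step)
  define l where "l = Abs_padic2 (\<lambda>n. residue (s n) n)"
  have "residue (s n) n = residue (s (Suc n)) (Suc n) mod 2 ^ n" for n
    using step[of n n] residue_le[of n "Suc n" "s (Suc n)"] by simp
  then have "residue l = (\<lambda>n. residue (s n) n)"
    unfolding l_def by (intro Abs_padic2_inverse CollectI allI)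
  then have "residue (s n) k = residue l k" if "k \<le> n" for n k
    using const[OF that] by simp
  then have "s \<longlonglongrightarrow> l"
    unfolding tendsto_padic2_iff eventually_sequentially by blast
  then show ?thesis
    by (auto simp: summable_def sums_def s_def[abs_def])
qed

lemma ex1_inverse_3: "\<exists>!y :: padic2. 3 * y = 1"
proof (rule ex_ex1I)
  define s where "s = (\<lambda>n. \<Sum>i<n. (4 :: padic2) ^ i)"
  have div4: "2 ^ n dvd (4 :: padic2) ^ n" for n
    using dvd_power_same[of "2 :: padic2" 4 n] by (metis dvd_triv_left mult_2_right numeral_Bit0)
  then obtain l where l: "s \<longlonglongrightarrow> l"
    using summable_padic2[of "\<lambda>i. 4 ^ i"] by (auto simp: s_def summable_def sums_def)
  have eq: "3 * s n = 4 ^ n - 1" for n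
    by (induction n) (simp_all add: s_def algebra_simps)
  have "3 * (- l) = 1"
  proof (rule padic2_eqI)
    fix k
    from l have "\<forall>\<^sub>F n in sequentially. residue (s n) k = residue l k"
      by (simp add: tendsto_padic2_iff)
    then obtain N where N: "\<And>n. n \<ge> N \<Longrightarrow> residue (s n) k = residue l k"
      by (auto simp: eventually_sequentially)
    define n where "n = max N k"
    have "2 ^ k dvd s n - l" using N[of n] by (simp add: n_def residue_eq_iff)
    then have "2 ^ k dvd 3 * (s n - l)" by (rule dvd_mult)
    moreover have "2 ^ k dvd (4 :: padic2) ^ n"
      by (rule dvd_trans[OF le_imp_power_dvd div4]) (simp add: n_def)
    ultimately have "2 ^ k dvd 3 * (s n - l) - 4 ^ n" by (rule dvd_diff)
    moreover have "3 * (s n - l) - 4 ^ n = 3 * (- l) - 1"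
      by (simp add: right_diff_distrib eq)
    ultimately show "residue (3 * (- l)) k = residue 1 k"
      by (simp only: residue_eq_iff)
  qed
  then show "\<exists>y :: padic2. 3 * y = 1" by blast
next
  fix y z :: padic2
  assume "3 * y = 1" "3 * z = 1"
  then show "y = z" by (metis mult.assoc mult.commute mult_1)
qed

section \<open>Binary expansions\<close>

definition digit :: "padic2 \<Rightarrow> nat \<Rightarrow> nat" where
  "digit x i = nat (residue x (Suc i) div 2 ^ i)"

lemma digit_01: "digit x i \<in> {0, 1}"
proof -
  have "residue x (Suc i) div 2 ^ i < 2"
  proof (rule ccontr)
    assume "\<not> residue x (Suc i) div 2 ^ i < 2"
    then have "2 * 2 ^ i \<le> residue x (Suc i) div 2 ^ i * 2 ^ i"
      by (intro mult_right_mono) simp_all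
    also have "\<dots> \<le> residue x (Suc i)"
      by (simp flip: minus_mod_eq_div_mult)
    finally show False using residue_less[of x "Suc i"] by simp
  qed
  then show ?thesis by (auto simp: digit_def)
qed

lemma residue_digit_sum: "residue x n = (\<Sum>i<n. int (digit x i) * 2 ^ i)"
proof (induction n)
  case 0
  show ?case using residue_Suc[of x 0] by simp
next
  case (Suc n)
  have "int (digit x n) = residue x (Suc n) div 2 ^ n"
    by (simp add: digit_def pos_imp_zdiv_nonneg_iff)
  then have "residue x (Suc n) = residue x n + int (digit x n) * 2 ^ n"
    using residue_Suc[of x n] by (metis add.commute div_mult_mod_eq)
  with Suc show ?case by simp
qed

lemma digit_sums: "(\<lambda>i. of_nat (digit x i) * 2 ^ i) sums x"
  unfolding sums_def tendsto_padic2_iff eventually_sequentially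
proof (intro allI exI impI)
  fix k n :: nat assume "k \<le> n"
  have "(\<Sum>i<n. of_nat (digit x i) * 2 ^ i) = (of_int (residue x n) :: padic2)"
    by (simp add: residue_digit_sum)
  then show "residue (\<Sum>i<n. of_nat (digit x i) * 2 ^ i) k = residue x k"
    using \<open>k \<le> n\<close> by (simp add: residue_of_int residue_le)
qed

lemma digit_unique:
  assumes d: "\<And>i. d i \<in> {0, 1 :: nat}" and s: "(\<lambda>i. of_nat (d i) * 2 ^ i) sums x"
  shows "d = digit x"
proof -
  have res: "residue x k = (\<Sum>i<k. int (d i) * 2 ^ i)" for k
  proof -
    have bound: "0 \<le> (\<Sum>i<k. int (d i) * 2 ^ i) \<and> (\<Sum>i<k. int (d i) * 2 ^ i) < 2 ^ k"
    proof (induction k)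
      case (Suc k)
      then show ?case using d[of k] by auto
    qed simp
    from s obtain N where
      N: "\<And>n. n \<ge> N \<Longrightarrow> residue (\<Sum>i<n. of_nat (d i) * 2 ^ i) k = residue x k"
      unfolding sums_def tendsto_padic2_iff eventually_sequentially by blast
    have "residue (\<Sum>i<n. of_nat (d i) * 2 ^ i) k = (\<Sum>i<k. int (d i) * 2 ^ i)"
      if "k \<le> n" for n using that
    proof (induction n rule: dec_induct)
      case base
      have "(\<Sum>i<k. of_nat (d i) * 2 ^ i) = (of_int (\<Sum>i<k. int (d i) * 2 ^ i) :: padic2)"
        by simp
      then show ?case using bound by (metis residue_of_int mod_pos_pos_trivial)
    next
      case (step n)
      have "(2 :: padic2) ^ k dvd of_nat (d n) * 2 ^ n"
        using step by (simp add: le_imp_power_dvd)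
      then have "residue (\<Sum>i<Suc n. of_nat (d i) * 2 ^ i) k
          = residue (\<Sum>i<n. of_nat (d i) * 2 ^ i) k"
        by (simp add: residue_eq_iff)
      with step show ?case by simp
    qed
    from this[of "max N k"] N[of "max N k"] show ?thesis by simp
  qed
  show ?thesis
  proof
    fix i
    have "int (d i) * 2 ^ i = int (digit x i) * 2 ^ i"
      using res[of "Suc i"] res[of i] residue_digit_sum[of x "Suc i"] residue_digit_sum[of x i]
      by simp
    then show "d i = digit x i" by simp
  qed
qed

section \<open>The maps\<close>

definition shift :: "padic2 \<Rightarrow> padic2" where
  "shift x = (\<Sum>i. of_nat (digit x (Suc i)) * 2 ^ i)"

definition L :: "nat \<Rightarrow> padic2 \<Rightarrow> nat" where
  "L k x = (LEAST m. 2 ^ k dvd x - of_nat m)"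

definition R :: "nat \<Rightarrow> padic2 \<Rightarrow> padic2" where
  "R k x = (shift ^^ k) x"

definition inv3 :: padic2 where
  "inv3 = (THE y. 3 * y = 1)"

text \<open>The exponents \<open>e_0 < e_1 < \<dots>\<close> with \<open>x = \<Sum>i. 2 ^ e_i\<close> are the values
  \<open>enumerate (exponents x) i\<close>, for \<open>i < card (exponents x)\<close> if there are finitely many.\<close>

definition exponents :: "padic2 \<Rightarrow> nat set" where
  "exponents x = {j. digit x j = 1}"

definition Phi :: "padic2 \<Rightarrow> padic2" where
  "Phi x =
    (if finite (exponents x)
     then - (\<Sum>i<card (exponents x). 2 ^ enumerate (exponents x) i * inv3 ^ i)
     else - (\<Sum>i. 2 ^ enumerate (exponents x) i * inv3 ^ i))"

text \<open>The elements \<open>a / b\<close> of the field of fractions, with integers \<open>a\<close> and \<open>b \<noteq> 0\<close>,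
  that lie in the ring.\<close>

definition rational_padic2 :: "padic2 set" where
  "rational_padic2 = {q. \<exists>a b :: int. b \<noteq> 0 \<and> of_int b * q = of_int a}"

definition eventually_periodic :: "(nat \<Rightarrow> 'a) \<Rightarrow> bool" where
  "eventually_periodic s \<longleftrightarrow> (\<exists>N p. p > 0 \<and> (\<forall>n\<ge>N. s (n + p) = s n))"

lemma inv3: "3 * inv3 = 1"
  unfolding inv3_def by (rule theI'[OF ex1_inverse_3])

lemma L_eq_residue: "L k x = nat (residue x k)"
  unfolding L_def
proof (rule Least_equality)
  show "2 ^ k dvd x - of_nat (nat (residue x k))"
    unfolding residue_eq_iff[symmetric] residue_of_nat by simp
next
  fix m assume "2 ^ k dvd x - of_nat m"
  then have "residue x k = int m mod 2 ^ k"
    by (simp flip: residue_eq_iff add: residue_of_nat)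
  also have "\<dots> \<le> int m" by (simp add: zmod_le_nonneg_dividend)
  finally show "nat (residue x k) \<le> m" by simp
qed

lemma L_eq_digit_sum: "L k x = (\<Sum>i<k. digit x i * 2 ^ i)"
proof -
  have "int (L k x) = int (\<Sum>i<k. digit x i * 2 ^ i)"
    by (simp add: L_eq_residue) (simp add: residue_digit_sum)
  then show ?thesis by (simp only: of_nat_eq_iff)
qed

lemma shift_sums: "(\<lambda>i. of_nat (digit x (Suc i)) * 2 ^ i) sums shift x"
  unfolding shift_def by (intro summable_sums summable_padic2) simp

lemma digit_shift: "digit (shift x) i = digit x (Suc i)"
  using digit_unique[OF _ shift_sums, of x] digit_01 by metis

lemma digit_R: "digit (R k x) i = digit x (k + i)"
  by (induction k arbitrary: i) (simp_all add: R_def digit_shift)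

lemma Phi_sums:
  assumes "infinite (exponents x)"
  shows "(\<lambda>i. 2 ^ enumerate (exponents x) i * inv3 ^ i) sums (- Phi x)"
proof -
  have "2 ^ i dvd 2 ^ enumerate (exponents x) i * inv3 ^ i" for i
    by (intro dvd_mult2 le_imp_power_dvd le_enumerate assms)
  then show ?thesis
    using assms by (simp add: Phi_def summable_sums summable_padic2)
qed

lemma exponents_sum:
  assumes "finite (exponents x)"
  shows "x = (\<Sum>i<card (exponents x). 2 ^ enumerate (exponents x) i)"
proof -
  have z: "of_nat (digit x n) * 2 ^ n = (0 :: padic2)" if "n \<notin> exponents x" for n
    using that digit_01[of x n] by (auto simp: exponents_def)
  have "x = (\<Sum>n\<in>exponents x. of_nat (digit x n) * 2 ^ n)"
    by (rule sums_unique2[OF digit_sums sums_finite[OF assms z]])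
  also have "\<dots> = (\<Sum>n\<in>exponents x. 2 ^ n)"
    by (rule sum.cong) (auto simp: exponents_def)
  also have "\<dots> = (\<Sum>i<card (exponents x). 2 ^ enumerate (exponents x) i)"
    by (rule sum.reindex_bij_betw[symmetric, OF finite_bij_enumerate[OF assms]])
  finally show ?thesis .
qed

lemma exponents_sums:
  assumes "infinite (exponents x)"
  shows "(\<lambda>i. 2 ^ enumerate (exponents x) i) sums x"
proof -
  have m: "strict_mono (enumerate (exponents x))"
    using assms by (simp add: strict_mono_enumerate)
  have z: "of_nat (digit x n) * 2 ^ n = (0 :: padic2)"
    if "n \<notin> range (enumerate (exponents x))" for n
    using that assms digit_01[of x n] by (auto simp: range_enumerate exponents_def)
  have "(\<lambda>i. of_nat (digit x (enumerate (exponents x) i)) * 2 ^ enumerate (exponents x) i) sums x"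
    using sums_mono_reindex[OF m, of "\<lambda>n. of_nat (digit x n) * 2 ^ n" x] z digit_sums[of x]
    by simp
  moreover have "digit x (enumerate (exponents x) i) = 1" for i
    using enumerate_in_set[OF assms, of i] by (simp add: exponents_def)
  ultimately show ?thesis by simp
qed

end

theory Submission
  imports Defs
begin

text \<open>
  Splitting the series for \<open>Phi q\<close> at position \<open>n\<close> gives
  \<open>Phi q = Phi (L n q) + 2 ^ n * 3 ^ (- m) * Phi (R n q)\<close>, where \<open>m\<close> is the number of ones among
  the first \<open>n\<close> digits of \<open>q\<close>. Applying \<open>R n\<close> causes no carries, so
  \<open>R n (Phi (L n q)) = R n (Phi q) - 3 ^ (- m) * Phi (R n q)\<close>. A 2-adic integer \<open>q\<close> with
  \<open>b * q = a\<close> has only finitely many shifts, since every \<open>b * R n q\<close> is a rational integer of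
  absolute value at most \<open>\<bar>a\<bar> + \<bar>b\<bar>\<close>; so \<open>R n q\<close> is eventually periodic in \<open>n\<close>. The splitting
  formula over one period shows that \<open>Phi q\<close> is rational again, hence \<open>R n (Phi q)\<close> is
  eventually periodic too. Finally \<open>3 ^ (- m)\<close> is eventually periodic modulo \<open>2 ^ H\<close>, because
  \<open>m\<close> grows by a multiple of \<open>2 ^ H\<close> over \<open>2 ^ H\<close> periods.
\<close>

section \<open>Integers and divisibility by powers of two in the 2-adic integers\<close>

lemma of_int_padic2_eq_0_iff: "(of_int b :: padic2) = 0 \<longleftrightarrow> b = 0"
proof
  assume *: "(of_int b :: padic2) = 0"
  have "b mod 2 ^ n = 0" for n
    using * residue_of_int[of b n] by (simp add: zero_padic2.rep_eq)
  \<comment> \<open>This exponent is large enough: a nonzero \<open>b\<close> cannot be divisible by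
    a power of two exceeding its absolute value.\<close>
  then have "2 ^ nat \<bar>b\<bar> dvd b" by (simp add: dvd_eq_mod_eq_0)
  then have "b \<noteq> 0 \<Longrightarrow> 2 ^ nat \<bar>b\<bar> \<le> \<bar>b\<bar>"
    using dvd_imp_le_int[of b "2 ^ nat \<bar>b\<bar>"] by simp
  moreover have "int (nat \<bar>b\<bar>) < 2 ^ nat \<bar>b\<bar>" by (rule of_nat_less_two_power)
  ultimately show "b = 0" by linarith
qed simp

lemma two_padic2_neq_0 [simp]: "(2 :: padic2) \<noteq> 0"
  using of_int_padic2_eq_0_iff[of 2] by simp

lemma two_power_dvd_of_int_iff: "(2 :: padic2) ^ n dvd of_int a \<longleftrightarrow> 2 ^ n dvd a"
  by (simp flip: residue_eq_0_iff add: residue_of_int dvd_eq_mod_eq_0)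

lemma padic2_eqI_dvd: "(\<And>n. 2 ^ n dvd x - y) \<Longrightarrow> x = y" for x y :: padic2
  by (rule padic2_eqI) (simp add: residue_eq_iff)

lemma dvd_diff_residue: "2 ^ n dvd x - of_int (residue x n)"
  unfolding residue_eq_iff[symmetric] residue_of_int by simp

section \<open>Splitting a 2-adic integer into its first digits and its shift\<close>

lemma of_nat_L: "of_nat (L n x) = (of_int (residue x n) :: padic2)"
  by (simp add: L_eq_residue of_nat_nat)

lemma residue_R: "residue x (n + k) = residue x n + 2 ^ n * residue (R n x) k"
  by (induction k) (simp_all add: residue_digit_sum digit_R algebra_simps power_add)

lemma L_add_R: "x = of_nat (L n x) + 2 ^ n * R n x"
proof (rule padic2_eqI_dvd)
  fix k
  \<comment> \<open>At precision \<open>n + k\<close> the residue of \<open>x\<close> holds exactly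
    \<open>k\<close> digits of the shift, so by \<open>residue_R\<close> the integer parts
    cancel.\<close>
  have "2 ^ k dvd x - of_int (residue x (n + k))"
    by (rule dvd_trans[OF _ dvd_diff_residue]) (simp add: le_imp_power_dvd)
  moreover have "2 ^ k dvd 2 ^ n * (R n x - of_int (residue (R n x) k))"
    by (rule dvd_mult[OF dvd_diff_residue])
  ultimately have "2 ^ k dvd
      (x - of_int (residue x (n + k))) - 2 ^ n * (R n x - of_int (residue (R n x) k))"
    by (rule dvd_diff)
  then show "2 ^ k dvd x - (of_nat (L n x) + 2 ^ n * R n x)"
    by (simp add: residue_R of_nat_L right_diff_distrib add_diff_add diff_diff_eq)
qed

text \<open>The added multiple of \<open>2 ^ n\<close> leaves the first \<open>n\<close> digits
  alone, so \<open>L_add_R\<close> gives both arguments the same head, and \<open>2 ^ n\<close>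
  cancels in an integral domain.\<close>

lemma R_add_two_power_mult: "R n (x + 2 ^ n * y) = R n x + y"
proof -
  have "residue (x + 2 ^ n * y) n = residue x n" by (simp add: residue_eq_iff)
  then have "L n (x + 2 ^ n * y) = L n x" by (simp add: L_eq_residue)
  then have "x + 2 ^ n * y = of_nat (L n x) + 2 ^ n * R n (x + 2 ^ n * y)"
    using L_add_R[of "x + 2 ^ n * y" n] by simp
  moreover have "x + 2 ^ n * y = of_nat (L n x) + 2 ^ n * (R n x + y)"
    unfolding distrib_left add.assoc[symmetric] L_add_R[of x n, symmetric] ..
  ultimately have "2 ^ n * R n (x + 2 ^ n * y) = 2 ^ n * (R n x + y)"
    by (metis add_left_cancel)
  then show ?thesis by simp
qed

section \<open>Repetition among the shifts of a rational 2-adic integer\<close>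

lemma R_R: "R m (R n x) = R (m + n) x"
  by (simp add: R_def funpow_add)

lemma R_periodic_from:
  assumes "R (n + p) x = R n x" and "n \<le> m"
  shows "R (m + p) x = R m x"
  using R_R[of "m - n" "n + p" x] R_R[of "m - n" n x] assms by simp

lemma rational_imp_R_repeats:
  assumes "q \<in> rational_padic2"
  obtains n p where "p > 0" "R (n + p) q = R n q"
proof -
  obtain a b :: int where b: "b \<noteq> 0" and q: "of_int b * q = of_int a"
    using assms unfolding rational_padic2_def by blast
  have "\<exists>t. of_int b * R n q = of_int t \<and> \<bar>t\<bar> \<le> \<bar>a\<bar> + \<bar>b\<bar>" for n
  proof -
    \<comment> \<open>Multiplying \<open>L_add_R\<close> by \<open>b\<close> replaces
      \<open>q\<close> by the integer \<open>a\<close>. The resulting integer is divisible by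
      \<open>2 ^ n\<close> in the 2-adic integers, hence among the integers.\<close>
    have e: "2 ^ n * (of_int b * R n q) = of_int (a - b * residue q n)"
      using arg_cong[OF L_add_R[of q n], of "\<lambda>x. of_int b * x"] q
      by (simp add: of_nat_L algebra_simps)
    then have "2 ^ n dvd a - b * residue q n"
      using two_power_dvd_of_int_iff by (metis dvd_triv_left)
    then obtain t where t: "a - b * residue q n = 2 ^ n * t" by (elim dvdE)
    have "2 ^ n * (of_int b * R n q) = 2 ^ n * of_int t" using e t by simp
    then have "of_int b * R n q = of_int t" by simp
    moreover have "\<bar>t\<bar> \<le> \<bar>a\<bar> + \<bar>b\<bar>"
    proof -
      have "2 ^ n * \<bar>t\<bar> = \<bar>a - b * residue q n\<bar>" by (simp add: t abs_mult)
      also have "\<dots> \<le> \<bar>a\<bar> + \<bar>b\<bar> * residue q n"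
        using abs_triangle_ineq4[of a "b * residue q n"] by (simp add: abs_mult)
      \<comment> \<open>Both summands are now bounded by multiples of \<open>2 ^ n\<close>, so
        dividing by it leaves a bound independent of \<open>n\<close>.\<close>
      also have "\<dots> \<le> 2 ^ n * \<bar>a\<bar> + \<bar>b\<bar> * 2 ^ n"
        by (intro add_mono mult_left_mono less_imp_le[OF residue_less])
          (simp_all add: mult_le_cancel_right1)
      finally have "2 ^ n * \<bar>t\<bar> \<le> 2 ^ n * (\<bar>a\<bar> + \<bar>b\<bar>)" by (simp add: algebra_simps)
      then show ?thesis by simp
    qed
    ultimately show ?thesis by blast
  qed
  then obtain t where t: "\<And>n. of_int b * R n q = of_int (t n)"
    and bound: "\<And>n. \<bar>t n\<bar> \<le> \<bar>a\<bar> + \<bar>b\<bar>" by metis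
  have "range t \<subseteq> {- (\<bar>a\<bar> + \<bar>b\<bar>)..\<bar>a\<bar> + \<bar>b\<bar>}" 
    using bound by (simp add: image_subset_iff abs_le_iff minus_le_iff flip: minus_add_distrib)
  then have "finite (range t)" using finite_subset by blast
  then have "\<not> inj t" using finite_imageD infinite_UNIV_nat by blast
  then obtain i j where ij: "i < j" "t i = t j"
    unfolding inj_def by (metis linorder_neqE_nat)
  have "of_int b * R i q = of_int b * R j q" using t ij by simp
  then have "R i q = R j q" using b by (simp add: of_int_padic2_eq_0_iff)
  then show ?thesis using ij that[of "j - i" i] by simp
qed

section \<open>The series of \<open>Phi\<close> summed over all digit positions\<close>

definition ones :: "padic2 \<Rightarrow> nat \<Rightarrow> nat" where
  "ones x n = (\<Sum>i<n. digit x i)"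

lemma ones_add: "ones x (n + k) = ones x n + ones (R n x) k"
  by (induction k) (simp_all add: ones_def digit_R)

lemma ones_eq_card: "ones x n = card {i \<in> exponents x. i < n}"
proof -
  have "ones x n = (\<Sum>i<n. if i \<in> exponents x then 1 else 0)"
    unfolding ones_def using digit_01[of x] by (intro sum.cong) (auto simp: exponents_def)
  also have "\<dots> = card {i \<in> exponents x. i < n}"
    by (simp add: sum.If_cases) (auto intro!: arg_cong[where f = card])
  finally show ?thesis .
qed

text \<open>Indexing by digit position instead of by exponent treats finite and infinite expansions
  alike and makes the splitting at position \<open>n\<close> termwise. At a one,
  \<open>ones x i\<close> is the number of earlier ones, that is, the index of the exponent
  \<open>i\<close>.\<close>

definition Phi_term :: "padic2 \<Rightarrow> nat \<Rightarrow> padic2" where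
  "Phi_term x i = of_nat (digit x i) * 2 ^ i * inv3 ^ ones x i"

lemma Phi_term_add: "Phi_term x (n + i) = 2 ^ n * inv3 ^ ones x n * Phi_term (R n x) i"
  by (simp add: Phi_term_def digit_R ones_add power_add)

text \<open>The exponents below the one of index \<open>i\<close> are exactly those of smaller
  index, so \<open>ones\<close> takes the value \<open>i\<close> there. In the finite case
  \<open>enumerate\<close> is meaningful only below the cardinality.\<close>

lemma Phi_term_enumerate:
  assumes "infinite (exponents x) \<or> i < card (exponents x)"
  shows "Phi_term x (enumerate (exponents x) i) = 2 ^ enumerate (exponents x) i * inv3 ^ i"
proof -
  let ?S = "exponents x"
  have mem: "enumerate ?S i \<in> ?S"
    using assms enumerate_in_set finite_enumerate_in_set by metis
  have "{j \<in> ?S. j < enumerate ?S i} = enumerate ?S ` {..<i}"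
  proof (intro equalityI subsetI)
    fix j assume j: "j \<in> {j \<in> ?S. j < enumerate ?S i}"
    show "j \<in> enumerate ?S ` {..<i}"
    proof (cases "finite ?S")
      case True
      then obtain k where k: "k < card ?S" "enumerate ?S k = j"
        using j finite_enumerate_Ex by blast
      then have "k < i" using j assms True finite_enumerate_mono_iff by auto
      then show ?thesis using k by blast
    next
      case False
      then obtain k where "enumerate ?S k = j" using j enumerate_Ex by blast
      then show ?thesis using j False by (auto simp: enumerate_mono_iff)
    qed
  next
    fix j assume "j \<in> enumerate ?S ` {..<i}"
    then show "j \<in> {j \<in> ?S. j < enumerate ?S i}"
      using assms by (cases "finite ?S")
        (auto simp: enumerate_in_set enumerate_mono finite_enumerate_in_set finite_enumerate_mono)
  qed
  moreover have "inj_on (enumerate ?S) {..<i}"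
  proof (rule inj_onI)
    fix j k assume "j \<in> {..<i}" "k \<in> {..<i}" "enumerate ?S j = enumerate ?S k"
    then show "j = k"
      using assms enumerate_mono[of j k ?S] enumerate_mono[of k j ?S]
        finite_enumerate_mono[of j k ?S] finite_enumerate_mono[of k j ?S]
      by (cases "finite ?S"; cases j k rule: linorder_cases) auto
  qed
  ultimately have "ones x (enumerate ?S i) = i"
    by (simp add: ones_eq_card card_image)
  then show ?thesis using mem by (simp add: Phi_term_def exponents_def)
qed

text \<open>Positions with digit zero contribute zero terms; inserting them changes neither a finite
  sum nor a series taken along a strictly increasing enumeration.\<close>

lemma Phi_term_sums: "Phi_term x sums (- Phi x)"
proof (cases "finite (exponents x)")
  case True
  have "(\<Sum>i<card (exponents x). 2 ^ enumerate (exponents x) i * inv3 ^ i)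
      = (\<Sum>i<card (exponents x). Phi_term x (enumerate (exponents x) i))"
    by (rule sum.cong) (simp_all add: Phi_term_enumerate)
  also have "\<dots> = sum (Phi_term x) (exponents x)"
    by (rule sum.reindex_bij_betw[OF finite_bij_enumerate[OF True]])
  finally have "- Phi x = sum (Phi_term x) (exponents x)" using True by (simp add: Phi_def)
  moreover have "Phi_term x i = 0" if "i \<notin> exponents x" for i
    using that digit_01[of x i] by (auto simp: Phi_term_def exponents_def)
  ultimately show ?thesis using sums_finite[OF True, of "Phi_term x"] by simp
next
  case False
  have "strict_mono (enumerate (exponents x))"
    using False by (simp add: strict_mono_enumerate)
  moreover have "Phi_term x i = 0" if "i \<notin> range (enumerate (exponents x))" for i
    using that False digit_01[of x i]
    by (auto simp: range_enumerate Phi_term_def exponents_def)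
  moreover have "(\<lambda>i. Phi_term x (enumerate (exponents x) i)) sums (- Phi x)"
    using Phi_sums[OF False] False by (simp add: Phi_term_enumerate)
  ultimately show ?thesis
    using sums_mono_reindex[of "enumerate (exponents x)" "Phi_term x"] by blast
qed

text \<open>Modulo \<open>2 ^ n\<close> the partial sums are constant from index \<open>n\<close>
  on. This turns identities between series into congruences between finite sums.\<close>

lemma padic2_sums_dvd_diff:
  fixes f :: "nat \<Rightarrow> padic2"
  assumes "f sums s" and "\<And>i. 2 ^ i dvd f i"
  shows "2 ^ n dvd s - sum f {..<n}"
proof -
  have const: "residue (sum f {..<m}) n = residue (sum f {..<n}) n" if "n \<le> m" for m
    using that
  proof (induction m rule: dec_induct)
    case (step m)
    have "2 ^ n dvd f m" using assms(2) step(1) by (meson dvd_trans le_imp_power_dvd)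
    then have "residue (sum f {..<Suc m}) n = residue (sum f {..<m}) n"
      by (simp add: residue_eq_iff)
    with step show ?case by simp
  qed simp
  obtain N where "\<And>m. m \<ge> N \<Longrightarrow> residue (sum f {..<m}) n = residue s n"
    using assms(1) unfolding sums_def tendsto_padic2_iff eventually_sequentially by blast
  from this[of "max N n"] const[of "max N n"] show ?thesis
    by (simp flip: residue_eq_iff)
qed

lemma Phi_dvd: "2 ^ n dvd Phi x + (\<Sum>i<n. Phi_term x i)"
proof -
  have "2 ^ n dvd - Phi x - sum (Phi_term x) {..<n}"
    by (rule padic2_sums_dvd_diff[OF Phi_term_sums]) (simp add: Phi_term_def)
  then show ?thesis by (metis dvd_minus_iff minus_add_distrib diff_conv_add_uminus minus_minus)
qed

lemma digit_of_nat_L: "digit (of_nat (L n x)) i = (if i < n then digit x i else 0)"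
proof -
  have "(\<lambda>i. of_nat (if i < n then digit x i else 0) * 2 ^ i) sums
      (\<Sum>i<n. of_nat (if i < n then digit x i else 0) * (2 :: padic2) ^ i)"
    by (rule sums_finite) auto
  also have "(\<Sum>i<n. of_nat (if i < n then digit x i else 0) * 2 ^ i) = (of_nat (L n x) :: padic2)"
    by (simp add: L_eq_digit_sum)
  finally have "(\<lambda>i. if i < n then digit x i else 0) = digit (of_nat (L n x))"
    using digit_01[of x] by (intro digit_unique) auto
  from fun_cong[OF this, of i] show ?thesis by simp
qed

lemma Phi_of_nat_L: "Phi (of_nat (L n x)) = - (\<Sum>i<n. Phi_term x i)"
proof -
  let ?y = "of_nat (L n x) :: padic2"
  have "Phi_term ?y i = Phi_term x i" if "i < n" for i
  proof -
    have "ones ?y i = ones x i"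
      unfolding ones_def using that by (intro sum.cong) (auto simp: digit_of_nat_L)
    then show ?thesis using that by (simp add: Phi_term_def digit_of_nat_L)
  qed
  moreover have "Phi_term ?y i = 0" if "i \<ge> n" for i
    using that by (simp add: Phi_term_def digit_of_nat_L)
  ultimately have "Phi_term ?y sums (\<Sum>i<n. Phi_term x i)"
    using sums_finite[of "{..<n}" "Phi_term ?y"] by simp
  then show ?thesis using sums_unique2[OF Phi_term_sums] by (metis minus_minus)
qed

text \<open>It suffices to argue modulo every \<open>2 ^ k\<close>. There \<open>Phi_dvd\<close>
  replaces the two series by finite sums of lengths \<open>n + k\<close> and \<open>k\<close>, which
  \<open>Phi_term_add\<close> matches term by term.\<close>

lemma Phi_split: "Phi x = Phi (of_nat (L n x)) + 2 ^ n * (inv3 ^ ones x n * Phi (R n x))"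
proof (rule padic2_eqI_dvd)
  fix k
  let ?c = "2 ^ n * inv3 ^ ones x n"
  have s: "(\<Sum>i<n + k. Phi_term x i) =
      (\<Sum>i<n. Phi_term x i) + ?c * (\<Sum>i<k. Phi_term (R n x) i)"
    by (induction k) (simp_all add: Phi_term_add distrib_left add.assoc)
  have "2 ^ k dvd Phi x + (\<Sum>i<n + k. Phi_term x i)"
    by (rule dvd_trans[OF _ Phi_dvd]) (simp add: le_imp_power_dvd)
  moreover have "2 ^ k dvd ?c * (Phi (R n x) + (\<Sum>i<k. Phi_term (R n x) i))"
    by (rule dvd_mult[OF Phi_dvd])
  ultimately have "2 ^ k dvd Phi x + (\<Sum>i<n + k. Phi_term x i)
      - ?c * (Phi (R n x) + (\<Sum>i<k. Phi_term (R n x) i))"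
    by (rule dvd_diff)
  then show "2 ^ k dvd Phi x -
      (Phi (of_nat (L n x)) + 2 ^ n * (inv3 ^ ones x n * Phi (R n x)))"
    by (simp add: s Phi_of_nat_L distrib_left mult.assoc diff_diff_eq2 add_diff_eq)
qed

corollary R_Phi_of_nat_L: "R n (Phi (of_nat (L n x))) = R n (Phi x) - inv3 ^ ones x n * Phi (R n x)"
  using arg_cong[OF Phi_split[of x n], of "R n"] by (simp add: R_add_two_power_mult)

section \<open>Closure properties of rational 2-adic integers and rationality of
  \<open>Phi q\<close>\<close>

lemma rational_of_int: "of_int a \<in> rational_padic2"
  unfolding rational_padic2_def by (rule CollectI, rule exI[of _ a], rule exI[of _ 1]) simp

lemma rational_inv3: "inv3 \<in> rational_padic2"
  unfolding rational_padic2_def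
  by (rule CollectI, rule exI[of _ 1], rule exI[of _ 3]) (simp add: inv3)

lemma rational_mult:
  assumes "x \<in> rational_padic2" "y \<in> rational_padic2"
  shows "x * y \<in> rational_padic2"
proof -
  obtain a b c d :: int where "b \<noteq> 0" "d \<noteq> 0" "of_int b * x = of_int a" "of_int d * y = of_int c"
    using assms unfolding rational_padic2_def by blast
  moreover have "of_int (b * d) * (x * y) = (of_int b * x) * (of_int d * y)"
    by (simp add: ac_simps)
  ultimately have "b * d \<noteq> 0" "of_int (b * d) * (x * y) = of_int (a * c)" by simp_all
  then show ?thesis unfolding rational_padic2_def by blast
qed

lemma rational_add:
  assumes "x \<in> rational_padic2" "y \<in> rational_padic2"
  shows "x + y \<in> rational_padic2"
proof -
  obtain a b c d :: int where *: "b \<noteq> 0" "d \<noteq> 0"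
    "of_int b * x = of_int a" "of_int d * y = of_int c"
    using assms unfolding rational_padic2_def by blast
  have "of_int (b * d) * (x + y) = of_int d * (of_int b * x) + of_int b * (of_int d * y)"
    by (simp add: algebra_simps)
  also have "\<dots> = of_int (d * a + b * c)" using * by simp
  finally have "of_int (b * d) * (x + y) = of_int (d * a + b * c)" .
  moreover have "b * d \<noteq> 0" using * by simp
  ultimately show ?thesis unfolding rational_padic2_def by blast
qed

lemma rational_minus: "x \<in> rational_padic2 \<Longrightarrow> - x \<in> rational_padic2"
  using rational_mult[OF rational_of_int[of "-1"]] by simp

lemma rational_power: "x \<in> rational_padic2 \<Longrightarrow> x ^ n \<in> rational_padic2"
  using rational_of_int[of 1] by (induction n) (simp_all add: rational_mult)

lemma rational_sum: "(\<And>i. i \<in> A \<Longrightarrow> f i \<in> rational_padic2) \<Longrightarrow> sum f A \<in> rational_padic2"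
  using rational_of_int[of 0]
  by (induction A rule: infinite_finite_induct) (simp_all add: rational_add)

lemma rational_Phi_of_nat_L: "Phi (of_nat (L n x)) \<in> rational_padic2"
proof -
  have "Phi_term x i \<in> rational_padic2" for i
    using rational_of_int[of "int (digit x i)"] rational_of_int[of 2]
    by (simp add: Phi_term_def rational_mult rational_power rational_inv3)
  then show ?thesis by (simp add: Phi_of_nat_L rational_minus rational_sum)
qed

lemma rational_cancel:
  assumes "of_int b * x \<in> rational_padic2" "b \<noteq> 0"
  shows "x \<in> rational_padic2"
proof -
  obtain a c :: int where "c \<noteq> 0" "of_int c * (of_int b * x) = of_int a"
    using assms(1) unfolding rational_padic2_def by blast
  then have "c * b \<noteq> 0" "of_int (c * b) * x = of_int a"
    using assms(2) by (simp_all add: mult.assoc)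
  then show ?thesis unfolding rational_padic2_def by blast
qed

text \<open>For the purely periodic tail \<open>y\<close>, \<open>Phi_split\<close> over one period
  is a linear equation for \<open>Phi y\<close> with rational coefficients. A second splitting
  restores the first \<open>n\<close> digits.\<close>

lemma R_repeats_imp_rational_Phi:
  assumes "R (n + p) q = R n q" and "p > 0"
  shows "Phi q \<in> rational_padic2"
proof -
  define y where "y = R n q"
  define c where "c = ones y p"
  have "R p y = y" using assms by (simp add: y_def R_R add.commute)
  then have "Phi y = Phi (of_nat (L p y)) + 2 ^ p * (inv3 ^ c * Phi y)"
    using Phi_split[of y p] by (simp add: c_def)
  then have "3 ^ c * Phi y = 3 ^ c * Phi (of_nat (L p y)) + 2 ^ p * ((3 ^ c * inv3 ^ c) * Phi y)"
    by (metis distrib_left mult.assoc mult.left_commute)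
  moreover have "(3 :: padic2) ^ c * inv3 ^ c = 1"
    by (simp add: inv3 flip: power_mult_distrib)
  ultimately have "of_int (3 ^ c - 2 ^ p) * Phi y = of_int (3 ^ c) * Phi (of_nat (L p y))"
    by (simp add: algebra_simps)
  moreover have "(3 :: int) ^ c - 2 ^ p \<noteq> 0"
  proof -
    \<comment> \<open>Parity shows that the linear equation is not degenerate: \<open>2 ^ p\<close>
      is even because \<open>p > 0\<close>.\<close>
    have "odd ((3 :: int) ^ c - 2 ^ p)" using assms(2) by simp
    then show ?thesis by (metis dvd_0_right)
  qed
  ultimately have "Phi y \<in> rational_padic2"
    by (metis rational_cancel rational_mult rational_of_int rational_Phi_of_nat_L)
  moreover have "(2 :: padic2) ^ n \<in> rational_padic2" using rational_of_int[of "2 ^ n"] by simp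
  ultimately show ?thesis
    using Phi_split[of q n]
    by (metis y_def rational_add rational_mult rational_power rational_inv3 rational_Phi_of_nat_L)
qed

section \<open>Periodicity of the powers of \<open>inv3\<close> and of combined sequences\<close>

lemma two_power_dvd_power_diff_1:
  fixes u :: "'a :: comm_ring_1"
  assumes "2 dvd u - 1"
  shows "2 ^ k dvd u ^ (2 ^ k) - 1"
proof (induction k)
  case (Suc k)
  \<comment> \<open>With \<open>v = u ^ (2 ^ k)\<close>, the next power minus 1 is
    \<open>(v + 1) * (v - 1)\<close>. As \<open>v + 1\<close> is even, each squaring gains a factor
    2.\<close>
  have "2 dvd u ^ (2 ^ k) - 1"
    using assms by (metis dvd_trans power_diff_1_eq dvd_triv_left)
  then have "2 dvd u ^ (2 ^ k) - 1 + 2" by (rule dvd_add) simp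
  then have "2 dvd u ^ (2 ^ k) + 1" by (simp add: algebra_simps)
  with Suc have "2 * 2 ^ k dvd (u ^ (2 ^ k) + 1) * (u ^ (2 ^ k) - 1)"
    by (rule mult_dvd_mono[rotated])
  also have "(u ^ (2 ^ k) + 1) * (u ^ (2 ^ k) - 1) = u ^ (2 ^ Suc k) - 1"
    by (simp add: algebra_simps mult_2 power_add)
  finally show ?case by simp
qed simp

text \<open>From \<open>3 * inv3 = 1\<close> comes \<open>inv3 - 1 = - 2 * inv3\<close>, so
  \<open>inv3\<close> and its powers are congruent to 1 modulo 2, and repeated squaring
  applies.\<close>

lemma residue_inv3_power: "residue (inv3 ^ (2 ^ k * m)) k = residue 1 k"
proof -
  have "inv3 - 1 = 2 * - inv3"
    using inv3 by (simp add: algebra_simps)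
  then have "2 dvd inv3 - 1" by (metis dvd_triv_left)
  then have "2 dvd inv3 ^ m - 1" by (metis dvd_trans power_diff_1_eq dvd_triv_left)
  then have "2 ^ k dvd (inv3 ^ m) ^ (2 ^ k) - 1" by (rule two_power_dvd_power_diff_1)
  then show ?thesis by (simp add: residue_eq_iff mult.commute flip: power_mult)
qed

text \<open>The two claims are proved jointly: counting the ones of the next period requires knowing
  that the shift has returned to \<open>R n x\<close>.\<close>

lemma ones_add_mult_period:
  assumes "R (n + p) x = R n x"
  shows "ones x (n + p * t) = ones x n + t * ones (R n x) p \<and> R (n + p * t) x = R n x"
proof (induction t)
  case (Suc t)
  have "R (n + p * t + p) x = R (n + p * t) x"
    by (rule R_periodic_from[OF assms]) simp
  then show ?case
    using Suc ones_add[of x "n + p * t" p] by (simp add: algebra_simps)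
qed simp

lemma eventually_periodic_comp2:
  assumes "eventually_periodic f" "eventually_periodic g"
  shows "eventually_periodic (\<lambda>n. h (f n) (g n))"
proof -
  obtain N p M r where p: "p > 0" "\<And>n. n \<ge> N \<Longrightarrow> f (n + p) = f n"
    and r: "r > 0" "\<And>n. n \<ge> M \<Longrightarrow> g (n + r) = g n"
    using assms unfolding eventually_periodic_def by metis
  have f: "f (n + p * t) = f n" if "n \<ge> N" for n t
    using that p(2)[of "n + p * _"] by (induction t) (simp_all add: algebra_simps)
  have g: "g (n + r * t) = g n" if "n \<ge> M" for n t
    using that r(2)[of "n + r * _"] by (induction t) (simp_all add: algebra_simps)
  show ?thesis unfolding eventually_periodic_def
    using f[of _ r] g[of _ p] p(1) r(1)
    by (intro exI[of _ "max N M"] exI[of _ "p * r"]) (simp add: mult.commute)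
qed

lemma eventually_periodic_R:
  assumes "q \<in> rational_padic2"
  shows "eventually_periodic (\<lambda>n. R n q)"
proof -
  obtain N p where "p > 0" "R (N + p) q = R N q"
    using rational_imp_R_repeats[OF assms] .
  then show ?thesis unfolding eventually_periodic_def using R_periodic_from by blast
qed

lemma eventually_periodic_inv3_power_ones:
  assumes "q \<in> rational_padic2"
  shows "eventually_periodic (\<lambda>n. residue (inv3 ^ ones q n) k)"
proof -
  obtain N p where p: "p > 0" "R (N + p) q = R N q"
    using rational_imp_R_repeats[OF assms] by metis
  have "residue (inv3 ^ ones q (n + p * 2 ^ k)) k = residue (inv3 ^ ones q n) k"
    if "n \<ge> N" for n
  proof -
    have "ones q (n + p * 2 ^ k) = ones q n + 2 ^ k * ones (R n q) p"
      using ones_add_mult_period R_periodic_from[OF p(2) that] by blast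
    then show ?thesis
      using residue_inv3_power[of k]
      by (metis power_add times_padic2.rep_eq mult.right_neutral)
  qed
  then show ?thesis
    unfolding eventually_periodic_def using p(1)
    by (intro exI[of _ N] exI[of _ "p * 2 ^ k"]) simp
qed

theorem theorem6:
  fixes H :: nat and q :: padic2
  assumes "H \<ge> 3" and "q \<in> rational_padic2"
  shows "eventually_periodic (\<lambda>n. L H (R n (Phi (of_nat (L n q)))))"
proof -
  have "Phi q \<in> rational_padic2"
    using rational_imp_R_repeats[OF assms(2)] R_repeats_imp_rational_Phi by metis
  then have "eventually_periodic (\<lambda>n. R n (Phi q))" by (rule eventually_periodic_R)
  \<comment> \<open>The factor \<open>Phi (R n q)\<close> depends on \<open>n\<close> only through
    \<open>R n q\<close>, so it inherits the periodicity of the shifts.\<close>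
  moreover have "eventually_periodic
      (\<lambda>n. residue (inv3 ^ ones q n) H * residue (Phi (R n q)) H mod 2 ^ H)"
    by (rule eventually_periodic_comp2[OF eventually_periodic_inv3_power_ones[OF assms(2)]
          eventually_periodic_R[OF assms(2)]])
  ultimately have "eventually_periodic (\<lambda>n. nat ((residue (R n (Phi q)) H
      - residue (inv3 ^ ones q n) H * residue (Phi (R n q)) H mod 2 ^ H) mod 2 ^ H))"
    by (rule eventually_periodic_comp2)
  then show ?thesis
    by (simp add: L_eq_residue[of H] R_Phi_of_nat_L minus_padic2.rep_eq times_padic2.rep_eq)
qed

end
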